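(* For each nonzero $\alpha\in\omega+1$, the space $\mathbf{L}_\alpha$ is an interior image of the Cantor space $\mathbf{C}$; that is, there is an onto interior map $\mathbf{C}\to\mathbf{L}_\alpha$.
   Context: For nonzero $\alpha\in\omega+1$ (so $\alpha$ is a positive integer, identified with $\{0,\dots,\alpha-1\}$, or $\alpha=\omega$), $T_\alpha$ is the set of finite $\alpha$-valued sequences (including the empty sequence), and $L_\alpha$ is $T_\alpha$ together with all infinite sequences $\omega\to\alpha$. Order $L_\alpha$ by $a\le b$ iff $a$ is an initial segment of $b$ (i.e. $\mathrm{dom}(a)\subseteq\mathrm{dom}(b)$ and $a(n)=b(n)$ for all $n\in\mathrm{dom}(a)$). This is a directed complete partial order; $\mathbf{L}_\alpha$ denotes $L_\alpha$ with the Scott topology, for which $\{\uparrow a: a\in T_\alpha\}$ is a basis, where $\uparrow a=\{b\in L_\alpha: a\le b\}$. A map between topological spaces is interior if it is continuous and open. *)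

theory Defs
  imports "HOL-Analysis.Analysis"
begin

text \<open>
  A nonzero element of \<open>\<omega> + 1\<close> is an \<open>\<alpha> :: enat\<close> with \<open>\<alpha> \<noteq> 0\<close>, the value \<open>\<infinity>\<close> standing for \<open>\<omega>\<close>.
  A sequence, finite or infinite, is a partial function on \<open>nat\<close> whose domain is an initial
  segment; the initial-segment order on sequences is then \<^const>\<open>map_le\<close>.
\<close>

definition fin_seqs :: "enat \<Rightarrow> (nat \<rightharpoonup> nat) set" where
  "fin_seqs \<alpha> = {a. (\<exists>n. dom a = {..<n}) \<and> ran a \<subseteq> {k. enat k < \<alpha>}}"

definition all_seqs :: "enat \<Rightarrow> (nat \<rightharpoonup> nat) set" where
  "all_seqs \<alpha> = fin_seqs \<alpha> \<union> {a. dom a = UNIV \<and> ran a \<subseteq> {k. enat k < \<alpha>}}"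

definition directed_in :: "'a set \<Rightarrow> ('a \<Rightarrow> 'a \<Rightarrow> bool) \<Rightarrow> 'a set \<Rightarrow> bool" where
  "directed_in A le D \<longleftrightarrow>
     D \<subseteq> A \<and> D \<noteq> {} \<and> (\<forall>x\<in>D. \<forall>y\<in>D. \<exists>z\<in>D. le x z \<and> le y z)"

definition is_sup_in :: "'a set \<Rightarrow> ('a \<Rightarrow> 'a \<Rightarrow> bool) \<Rightarrow> 'a set \<Rightarrow> 'a \<Rightarrow> bool" where
  "is_sup_in A le D s \<longleftrightarrow>
     s \<in> A \<and> (\<forall>d\<in>D. le d s) \<and> (\<forall>u\<in>A. (\<forall>d\<in>D. le d u) \<longrightarrow> le s u)"

definition scott_open :: "'a set \<Rightarrow> ('a \<Rightarrow> 'a \<Rightarrow> bool) \<Rightarrow> 'a set \<Rightarrow> bool" where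
  "scott_open A le U \<longleftrightarrow>
     U \<subseteq> A \<and>
     (\<forall>x\<in>U. \<forall>y\<in>A. le x y \<longrightarrow> y \<in> U) \<and>
     (\<forall>D s. directed_in A le D \<longrightarrow> is_sup_in A le D s \<longrightarrow> s \<in> U \<longrightarrow> D \<inter> U \<noteq> {})"

definition scott_topology :: "'a set \<Rightarrow> ('a \<Rightarrow> 'a \<Rightarrow> bool) \<Rightarrow> 'a topology" where
  "scott_topology A le = topology (scott_open A le)"

definition L_space :: "enat \<Rightarrow> (nat \<rightharpoonup> nat) topology" where
  "L_space \<alpha> = scott_topology (all_seqs \<alpha>) (\<subseteq>\<^sub>m)"

definition cantor_space :: "(nat \<Rightarrow> bool) topology" where
  "cantor_space = product_topology (\<lambda>_. discrete_topology UNIV) UNIV"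

definition interior_map :: "'a topology \<Rightarrow> 'b topology \<Rightarrow> ('a \<Rightarrow> 'b) \<Rightarrow> bool" where
  "interior_map X Y f \<longleftrightarrow> continuous_map X Y f \<and> open_map X Y f"

lemma istopology_scott_open: "istopology (scott_open A le)"
  unfolding istopology_def
proof (intro conjI allI impI)
  fix U V assume U: "scott_open A le U" and V: "scott_open A le V"
  have "D \<inter> (U \<inter> V) \<noteq> {}"
    if D: "directed_in A le D" and s: "is_sup_in A le D s" "s \<in> U \<inter> V" for D s
  proof -
    obtain x where x: "x \<in> D" "x \<in> U" using U D s unfolding scott_open_def by blast
    obtain y where y: "y \<in> D" "y \<in> V" using V D s unfolding scott_open_def by blast
    obtain z where z: "z \<in> D" "le x z" "le y z" "z \<in> A"
      using D x y unfolding directed_in_def by blast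
    then have "z \<in> U" "z \<in> V" using U V x y unfolding scott_open_def by blast+
    then show ?thesis using z by blast
  qed
  then show "scott_open A le (U \<inter> V)"
    using U V unfolding scott_open_def by blast
next
  fix K assume K: "\<forall>U\<in>K. scott_open A le U"
  show "scott_open A le (\<Union>K)"
    unfolding scott_open_def
  proof (intro conjI allI impI ballI)
    show "\<Union>K \<subseteq> A" using K by (auto simp: scott_open_def)
  next
    fix x y assume "x \<in> \<Union>K" "y \<in> A" "le x y"
    then show "y \<in> \<Union>K" using K by (auto simp: scott_open_def)
  next
    fix D s assume D: "directed_in A le D" "is_sup_in A le D s" and "s \<in> \<Union>K"
    then obtain U where "U \<in> K" "s \<in> U" by blast
    then have "D \<inter> U \<noteq> {}" using K D by (simp add: scott_open_def)
    then show "D \<inter> \<Union>K \<noteq> {}" using \<open>U \<in> K\<close> by blast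
  qed
qed

lemma openin_scott_topology: "openin (scott_topology A le) = scott_open A le"
  by (simp add: scott_topology_def istopology_scott_open)

lemma topspace_scott_topology: "topspace (scott_topology A le) = A"
proof -
  have "scott_open A le A"
    unfolding scott_open_def directed_in_def by blast
  then show ?thesis
    unfolding topspace_def openin_scott_topology by (auto simp: scott_open_def)
qed

lemma topspace_L_space: "topspace (L_space \<alpha>) = all_seqs \<alpha>"
  by (simp add: L_space_def topspace_scott_topology)

lemma all_seqs_dom_downward: "a \<in> all_seqs \<alpha> \<Longrightarrow> n \<in> dom a \<Longrightarrow> m \<le> n \<Longrightarrow> m \<in> dom a"
proof -
  assume a: "a \<in> all_seqs \<alpha>" and "n \<in> dom a" "m \<le> n"
  obtain k where "dom a = {..<k} \<or> dom a = UNIV"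
    using a unfolding all_seqs_def fin_seqs_def by blast
  with \<open>n \<in> dom a\<close> \<open>m \<le> n\<close> show ?thesis
    by (metis UNIV_I le_less_trans lessThan_iff)
qed

lemma restrict_in_fin_seqs:
  assumes "a \<in> all_seqs \<alpha>"
  shows "a |` {..<n} \<in> fin_seqs \<alpha>"
proof -
  have "\<exists>m. dom (a |` {..<n}) = {..<m}"
  proof -
    consider m where "dom a = {..<m}" | "dom a = UNIV"
      using assms unfolding all_seqs_def fin_seqs_def by blast
    then show ?thesis
    proof cases
      case 1
      then have "dom (a |` {..<n}) = {..<min m n}" by auto
      then show ?thesis by blast
    next
      case 2
      then have "dom (a |` {..<n}) = {..<n}" by simp
      then show ?thesis by blast
    qed
  qed
  moreover have "ran (a |` {..<n}) \<subseteq> ran a"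
    by (auto simp: ran_def restrict_map_def)
  ultimately show ?thesis
    using assms unfolding all_seqs_def fin_seqs_def by blast
qed

lemma fin_seqs_compact:
  assumes a: "a \<in> fin_seqs \<alpha>" and D: "directed_in (all_seqs \<alpha>) (\<subseteq>\<^sub>m) D"
    and s: "is_sup_in (all_seqs \<alpha>) (\<subseteq>\<^sub>m) D s" and le: "a \<subseteq>\<^sub>m s"
  shows "\<exists>d\<in>D. a \<subseteq>\<^sub>m d"
proof -
  obtain n where n: "dom a = {..<n}" using a unfolding fin_seqs_def by blast
  have ds: "d \<subseteq>\<^sub>m s" "d \<in> all_seqs \<alpha>" if "d \<in> D" for d
    using s D that unfolding is_sup_in_def directed_in_def by auto
  have "\<exists>d\<in>D. {..<n} \<subseteq> dom d"
  proof (cases n)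
    case 0
    then show ?thesis using D unfolding directed_in_def by auto
  next
    case (Suc m)
    show ?thesis
    proof (rule ccontr)
      assume "\<not> ?thesis"
      then have sm: "dom d \<subseteq> {..<m}" if "d \<in> D" for d
        using that ds(2)[OF that] all_seqs_dom_downward[of d \<alpha>] Suc
        by (metis lessThan_iff less_Suc_eq_le not_le_imp_less subsetI)
      let ?r = "s |` {..<m}"
      have "s \<in> all_seqs \<alpha>" using s unfolding is_sup_in_def by blast
      then have "?r \<in> all_seqs \<alpha>"
        using restrict_in_fin_seqs unfolding all_seqs_def by blast
      moreover have "d \<subseteq>\<^sub>m ?r" if "d \<in> D" for d
        using sm[OF that] ds(1)[OF that] by (auto simp: map_le_def restrict_map_def)
      ultimately have "s \<subseteq>\<^sub>m ?r" using s unfolding is_sup_in_def by blast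
      then have "m \<notin> dom s"
        using map_le_implies_dom_le by fastforce
      moreover have "m \<in> dom s" using map_le_implies_dom_le[OF le] n Suc by auto
      ultimately show False by blast
    qed
  qed
  then obtain d where "d \<in> D" "{..<n} \<subseteq> dom d" by blast
  then have "a \<subseteq>\<^sub>m d"
    using ds(1)[of d] le n unfolding map_le_def by (metis subsetD)
  then show ?thesis using \<open>d \<in> D\<close> by blast
qed

text \<open>The up-sets of the finite sequences form a basis of the Scott topology.\<close>

lemma openin_L_space_iff:
  "openin (L_space \<alpha>) U \<longleftrightarrow>
     U \<subseteq> all_seqs \<alpha> \<and>
     (\<forall>x\<in>U. \<exists>a\<in>fin_seqs \<alpha>. a \<subseteq>\<^sub>m x \<and> {b \<in> all_seqs \<alpha>. a \<subseteq>\<^sub>m b} \<subseteq> U)"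
proof
  assume "openin (L_space \<alpha>) U"
  then have U: "scott_open (all_seqs \<alpha>) (\<subseteq>\<^sub>m) U"
    by (simp add: L_space_def openin_scott_topology)
  have "\<exists>a\<in>fin_seqs \<alpha>. a \<subseteq>\<^sub>m x \<and> {b \<in> all_seqs \<alpha>. a \<subseteq>\<^sub>m b} \<subseteq> U" if "x \<in> U" for x
  proof -
    have x: "x \<in> all_seqs \<alpha>" using U that unfolding scott_open_def by blast
    let ?D = "range (\<lambda>n. x |` {..<n})"
    have 1: "directed_in (all_seqs \<alpha>) (\<subseteq>\<^sub>m) ?D"
      unfolding directed_in_def
    proof (intro conjI ballI)
      show "?D \<subseteq> all_seqs \<alpha>"
        using restrict_in_fin_seqs[OF x] unfolding all_seqs_def by blast
      fix y z assume "y \<in> ?D" "z \<in> ?D"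
      then obtain m n where "y = x |` {..<m}" "z = x |` {..<n}" by blast
      then have "y \<subseteq>\<^sub>m x |` {..<max m n}" "z \<subseteq>\<^sub>m x |` {..<max m n}"
        by (auto simp: map_le_def restrict_map_def)
      then show "\<exists>w\<in>?D. y \<subseteq>\<^sub>m w \<and> z \<subseteq>\<^sub>m w" by blast
    qed simp
    have 2: "is_sup_in (all_seqs \<alpha>) (\<subseteq>\<^sub>m) ?D x"
      unfolding is_sup_in_def
    proof (intro conjI ballI impI)
      fix u assume u: "\<forall>d\<in>?D. d \<subseteq>\<^sub>m u"
      show "x \<subseteq>\<^sub>m u"
        unfolding map_le_def
      proof
        fix k assume k: "k \<in> dom x"
        have "x |` {..<Suc k} \<subseteq>\<^sub>m u" using u by blast
        then show "x k = u k"
          using k unfolding map_le_def by (auto simp: restrict_map_def split: if_splits)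
      qed
    qed (use x in \<open>auto simp: map_le_def restrict_map_def split: if_splits\<close>)
    from U 1 2 \<open>x \<in> U\<close> have "?D \<inter> U \<noteq> {}" unfolding scott_open_def by blast
    then obtain n where "x |` {..<n} \<in> U" by blast
    then have "{b \<in> all_seqs \<alpha>. x |` {..<n} \<subseteq>\<^sub>m b} \<subseteq> U"
      using U unfolding scott_open_def by blast
    moreover have "x |` {..<n} \<subseteq>\<^sub>m x" by (auto simp: map_le_def restrict_map_def)
    ultimately show ?thesis using restrict_in_fin_seqs[OF x] by blast
  qed
  then show "U \<subseteq> all_seqs \<alpha> \<and>
     (\<forall>x\<in>U. \<exists>a\<in>fin_seqs \<alpha>. a \<subseteq>\<^sub>m x \<and> {b \<in> all_seqs \<alpha>. a \<subseteq>\<^sub>m b} \<subseteq> U)"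
    using U unfolding scott_open_def by blast
next
  assume R: "U \<subseteq> all_seqs \<alpha> \<and>
     (\<forall>x\<in>U. \<exists>a\<in>fin_seqs \<alpha>. a \<subseteq>\<^sub>m x \<and> {b \<in> all_seqs \<alpha>. a \<subseteq>\<^sub>m b} \<subseteq> U)"
  have "D \<inter> U \<noteq> {}"
    if D: "directed_in (all_seqs \<alpha>) (\<subseteq>\<^sub>m) D" and s: "is_sup_in (all_seqs \<alpha>) (\<subseteq>\<^sub>m) D s"
      and "s \<in> U" for D s
  proof -
    obtain a where a: "a \<in> fin_seqs \<alpha>" "a \<subseteq>\<^sub>m s" "{b \<in> all_seqs \<alpha>. a \<subseteq>\<^sub>m b} \<subseteq> U"
      using R \<open>s \<in> U\<close> by blast
    then obtain d where "d \<in> D" "a \<subseteq>\<^sub>m d" using fin_seqs_compact[OF _ D s] by blast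
    then show ?thesis using a(3) D unfolding directed_in_def by blast
  qed
  moreover have "y \<in> U" if "x \<in> U" "y \<in> all_seqs \<alpha>" "x \<subseteq>\<^sub>m y" for x y
    using R that map_le_trans by blast
  ultimately show "openin (L_space \<alpha>) U"
    using R unfolding L_space_def openin_scott_topology scott_open_def by blast
qed

end

theory Submission
  imports Defs "HOL-Library.Nat_Bijection"
begin

text \<open>
  Label every natural number by a value below \<open>\<alpha>\<close> in such a way that each value labels arbitrarily
  large numbers. A point \<open>x\<close> of the Cantor space is a set of marked positions; reading off the
  labels of the marked positions in increasing order gives a sequence \<open>read g x\<close>, which is finite
  or infinite according to whether \<open>x\<close> marks finitely or infinitely many positions. This is the
  required map.

  It is continuous because finitely many entries of \<open>read g x\<close> depend only on a finite part of
  \<open>x\<close>, and the remaining part can only lengthen the sequence. It is open and onto because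
  it sends the basic open set of all points agreeing with \<open>x\<close> below \<open>m\<close> \<^emph>\<open>exactly\<close> onto the basic
  open set \<open>\<up>a\<close>, where \<open>a\<close> is what has been read below \<open>m\<close> (for \<open>m = 0\<close>, this is the whole
  space). Indeed, any extension \<open>b\<close> of \<open>a\<close> is read by a point that agrees with \<open>x\<close> below \<open>m\<close>
  and from \<open>m\<close> onwards greedily marks a position whenever its label is the next entry of \<open>b\<close> still
  to be read; recurrence of the labels ensures that the search for the next entry always ends.
  Recurrence is the crucial point: if some value labelled no position from \<open>m\<close> onwards, it could no
  longer occur as the next entry, and the image would not be an up-set.
  The lemma \<open>read_onto_upset\<close> carries this argument.
\<close>

section \<open>Reading labels at marked positions\<close>

definition marks_below :: "(nat \<Rightarrow> bool) \<Rightarrow> nat \<Rightarrow> nat" where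
  "marks_below x p = card {i. i < p \<and> x i}"

definition read :: "(nat \<Rightarrow> 'a) \<Rightarrow> (nat \<Rightarrow> bool) \<Rightarrow> (nat \<rightharpoonup> 'a)" where
  "read g x n =
     (if \<exists>p. x p \<and> marks_below x p = n then Some (g (THE p. x p \<and> marks_below x p = n)) else None)"

lemma marks_below_0 [simp]: "marks_below x 0 = 0"
  by (simp add: marks_below_def)

lemma marks_below_Suc [simp]:
  "marks_below x (Suc p) = (if x p then Suc (marks_below x p) else marks_below x p)"
proof -
  have "{i. i < Suc p \<and> x i} = (if x p then insert p {i. i < p \<and> x i} else {i. i < p \<and> x i})"
    by (auto simp: less_Suc_eq)
  then show ?thesis
    by (simp add: marks_below_def)
qed

lemma marks_below_mono: "p \<le> q \<Longrightarrow> marks_below x p \<le> marks_below x q"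
  unfolding marks_below_def by (rule card_mono) auto

lemma marks_below_le: "marks_below x p \<le> p"
  by (induction p) auto

lemma marks_below_cong:
  assumes "\<And>i. i < p \<Longrightarrow> x i = y i"
  shows "marks_below x p = marks_below y p"
  unfolding marks_below_def using assms by (metis (mono_tags, lifting))

lemma marked_position_unique:
  assumes "x p" "x q" "marks_below x p = marks_below x q"
  shows "p = q"
proof -
  have "marks_below x i < marks_below x j" if "i < j" "x i" for i j
    using marks_below_mono[of "Suc i" j x] that by simp
  then show ?thesis
    using assms by (metis less_irrefl linorder_neqE_nat)
qed

lemma read_eq_Some_iff:
  "read g x n = Some v \<longleftrightarrow> (\<exists>p. x p \<and> marks_below x p = n \<and> g p = v)"
proof -
  have "(THE q. x q \<and> marks_below x q = n) = p" if "x p" "marks_below x p = n" for p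
    using that by (intro the_equality) (auto intro: marked_position_unique)
  then show ?thesis
    unfolding read_def by auto
qed

lemma map_le_iff_Some: "a \<subseteq>\<^sub>m b \<longleftrightarrow> (\<forall>n v. a n = Some v \<longrightarrow> b n = Some v)"
  unfolding map_le_def by (metis domD domI)

lemma read_map_le_iff:
  "read g x \<subseteq>\<^sub>m b \<longleftrightarrow> (\<forall>p. x p \<longrightarrow> b (marks_below x p) = Some (g p))"
  by (auto simp: map_le_iff_Some read_eq_Some_iff)

lemma dom_read_downward:
  assumes "n \<in> dom (read g x)" "k \<le> n"
  shows "k \<in> dom (read g x)"
proof -
  \<comment> \<open>the count of marks grows by at most one per position, so it skips no value\<close>
  have *: "\<exists>q. x q \<and> marks_below x q = k" if "k < marks_below x p" for p k
    using that by (induction p) (auto split: if_splits simp: less_Suc_eq)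
  show ?thesis
    using assms * unfolding dom_def by (auto simp: read_eq_Some_iff le_less)
qed

lemma initial_segment_cases:
  fixes D :: "nat set"
  assumes "\<And>n k. n \<in> D \<Longrightarrow> k \<le> n \<Longrightarrow> k \<in> D"
  shows "D = UNIV \<or> (\<exists>n. D = {..<n})"
proof (cases "D = UNIV")
  case False
  then have notin: "(LEAST n. n \<notin> D) \<notin> D"
    by (metis LeastI UNIV_eq_I)
  have "D = {..<(LEAST n. n \<notin> D)}"
    using assms notin not_less_Least by (metis (lifting) lessThan_iff not_le_imp_less subsetI subset_antisym)
  then show ?thesis by blast
qed simp

lemma read_in_all_seqs:
  assumes "\<And>p. enat (g p) < \<alpha>"
  shows "read g x \<in> all_seqs \<alpha>"
proof -
  have "ran (read g x) \<subseteq> {k. enat k < \<alpha>}"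
    using assms by (auto simp: ran_def read_eq_Some_iff)
  moreover have "dom (read g x) = UNIV \<or> (\<exists>n. dom (read g x) = {..<n})"
    by (rule initial_segment_cases) (rule dom_read_downward)
  ultimately show ?thesis
    unfolding all_seqs_def fin_seqs_def by blast
qed

section \<open>What is read from a finite part\<close>

definition truncate :: "nat \<Rightarrow> (nat \<Rightarrow> bool) \<Rightarrow> (nat \<Rightarrow> bool)" where
  "truncate m x = (\<lambda>i. i < m \<and> x i)"

lemma marks_below_truncate: "p \<le> m \<Longrightarrow> marks_below (truncate m x) p = marks_below x p"
  by (rule marks_below_cong) (simp add: truncate_def)

lemma read_truncate_in_fin_seqs:
  assumes "\<And>p. enat (g p) < \<alpha>"
  shows "read g (truncate m x) \<in> fin_seqs \<alpha>"
proof -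
  have "dom (read g (truncate m x)) \<subseteq> {..<m}"
  proof
    fix n assume "n \<in> dom (read g (truncate m x))"
    then obtain p where "p < m" "marks_below (truncate m x) p = n"
      by (auto simp: dom_def read_eq_Some_iff truncate_def)
    then show "n \<in> {..<m}"
      using marks_below_le[of "truncate m x" p] by simp
  qed
  then have "dom (read g (truncate m x)) \<noteq> UNIV"
    by (metis finite_lessThan finite_subset infinite_UNIV_nat)
  moreover have "read g (truncate m x) \<in> all_seqs \<alpha>"
    by (rule read_in_all_seqs) (rule assms)
  ultimately show ?thesis
    unfolding all_seqs_def by blast
qed

lemma read_truncate_le:
  assumes "\<And>i. i < m \<Longrightarrow> y i = x i"
  shows "read g (truncate m x) \<subseteq>\<^sub>m read g y"
proof -
  have "truncate m x = truncate m y"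
    using assms by (auto simp: truncate_def)
  then show ?thesis
    using marks_below_truncate
    by (fastforce simp: read_map_le_iff read_eq_Some_iff truncate_def)
qed

text \<open>Each entry is read at one position, so any bound on finitely many such positions will do.\<close>

lemma finite_part_read_from_truncation:
  assumes "finite (dom a)" "a \<subseteq>\<^sub>m read g x"
  shows "\<exists>m. a \<subseteq>\<^sub>m read g (truncate m x)"
proof -
  have "\<exists>p. x p \<and> marks_below x p = n \<and> a n = Some (g p)" if "n \<in> dom a" for n
    using assms(2) that by (fastforce simp: map_le_iff_Some read_eq_Some_iff)
  then obtain P where P: "\<And>n. n \<in> dom a \<Longrightarrow> x (P n) \<and> marks_below x (P n) = n \<and> a n = Some (g (P n))"
    by metis
  obtain m where m: "\<And>n. n \<in> dom a \<Longrightarrow> P n < m"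
    using assms(1) finite_nat_set_iff_bounded[of "P ` dom a"] by auto
  have "read g (truncate m x) n = Some v" if "a n = Some v" for n v
  proof -
    have "n \<in> dom a" using that by blast
    then have "truncate m x (P n)" "marks_below (truncate m x) (P n) = n" "g (P n) = v"
      using P m that by (auto simp: truncate_def marks_below_truncate[unfolded truncate_def] less_imp_le)
    then show ?thesis by (auto simp: read_eq_Some_iff)
  qed
  then show ?thesis by (auto simp: map_le_iff_Some)
qed

section \<open>Greedy marking\<close>

text \<open>
  The number of marks below each position when \<open>x\<close> is followed below \<open>m\<close> and, from \<open>m\<close> onwards, a
  position is marked iff its label is the next entry of \<open>b\<close> to be read. The recursion runs
  over the counts because whether a position is marked depends on the past only through them.
\<close>

primrec greedy_count :: "(nat \<Rightarrow> 'a) \<Rightarrow> nat \<Rightarrow> (nat \<Rightarrow> bool) \<Rightarrow> (nat \<rightharpoonup> 'a) \<Rightarrow> nat \<Rightarrow> nat" where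
  "greedy_count g m x b 0 = 0"
| "greedy_count g m x b (Suc i) =
     (if (if i < m then x i else b (greedy_count g m x b i) = Some (g i))
      then Suc (greedy_count g m x b i) else greedy_count g m x b i)"

lemma greedy_marking_exists:
  "\<exists>y. \<forall>i. y i = (if i < m then x i else b (marks_below y i) = Some (g i))"
proof -
  define y where "y = (\<lambda>i. if i < m then x i else b (greedy_count g m x b i) = Some (g i))"
  have "marks_below y i = greedy_count g m x b i" for i
    by (induction i) (auto simp: y_def)
  then show ?thesis by (intro exI[of _ y]) (simp add: y_def)
qed

text \<open>
  The greedy marking never reads anything but entries of \<open>b\<close>: below \<open>m\<close> because \<open>b\<close> extends what
  \<open>x\<close> has already read, and beyond by construction. It reads every entry: once all entries before
  the \<open>k\<close>-th are read, the count would stay at \<open>k\<close> for ever if the \<open>k\<close>-th were not read, but then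
  the next position with the right label would be marked.
\<close>

lemma read_onto_upset:
  assumes recurrent: "\<And>v l. v \<in> ran b \<Longrightarrow> \<exists>p\<ge>l. g p = v"
    and initial: "\<And>n k. n \<in> dom b \<Longrightarrow> k \<le> n \<Longrightarrow> k \<in> dom b"
    and le: "read g (truncate m x) \<subseteq>\<^sub>m b"
  shows "\<exists>y. (\<forall>i<m. y i = x i) \<and> read g y = b"
proof -
  obtain y where y: "\<And>i. y i = (if i < m then x i else b (marks_below y i) = Some (g i))"
    using greedy_marking_exists by metis
  have agree: "y i = x i" if "i < m" for i
    using y that by simp
  have "b (marks_below y p) = Some (g p)" if "y p" for p
  proof (cases "p < m")
    case True
    then have "marks_below (truncate m x) p = marks_below y p"
      by (intro marks_below_cong) (simp add: truncate_def agree)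
    moreover have "truncate m x p"
      using True that agree by (simp add: truncate_def)
    ultimately show ?thesis
      using le by (metis read_map_le_iff)
  qed (use y that in simp)
  then have sound: "read g y \<subseteq>\<^sub>m b"
    by (simp add: read_map_le_iff)
  have step: "\<exists>p. y p \<and> marks_below y p = k" if k: "k \<in> dom b" and i: "marks_below y i = k" for k i
  proof (rule ccontr)
    assume unread: "\<not> ?thesis"
    have stuck: "marks_below y j = k" if "j \<ge> i" for j
      using that by (induction j rule: dec_induct) (use i unread in auto)
    obtain v where v: "b k = Some v" using k by blast
    then obtain p where p: "p \<ge> max i m" "g p = v"
      using recurrent ranI by metis
    then have "y p" using y[of p] v stuck[of p] by simp
    then show False using unread stuck p by auto
  qed
  have "k \<in> dom b \<Longrightarrow> \<exists>p. y p \<and> marks_below y p = k" for k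
  proof (induction k)
    case 0
    then show ?case using step[of 0 0] by simp
  next
    case (Suc k)
    then obtain p where "y p" "marks_below y p = k" using initial[of "Suc k" k] by auto
    then have "marks_below y (Suc p) = Suc k" by simp
    then show ?case using step Suc.prems by blast
  qed
  then have "dom b \<subseteq> dom (read g y)"
    by (fastforce simp: read_eq_Some_iff dom_def)
  then have "read g y = b"
    using sound by (metis map_le_antisym map_le_def subsetD)
  then show ?thesis using agree by blast
qed

section \<open>The reading map on the Cantor space\<close>

lemma topspace_cantor_space: "topspace cantor_space = UNIV"
  by (simp add: cantor_space_def)

lemma openin_cantor_space_iff:
  "openin cantor_space U \<longleftrightarrow> (\<forall>x\<in>U. \<exists>m. \<forall>y. (\<forall>i<m. y i = x i) \<longrightarrow> y \<in> U)"
proof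
  assume U: "openin cantor_space U"
  show "\<forall>x\<in>U. \<exists>m. \<forall>y. (\<forall>i<m. y i = x i) \<longrightarrow> y \<in> U"
  proof
    fix x assume "x \<in> U"
    then obtain W where W: "finite {i. W i \<noteq> UNIV}" "x \<in> PiE UNIV W" "PiE UNIV W \<subseteq> U"
      using U unfolding cantor_space_def openin_product_topology_alt by auto
    obtain m where m: "\<And>i. W i \<noteq> UNIV \<Longrightarrow> i < m"
      using W(1) finite_nat_set_iff_bounded by auto
    have "y \<in> U" if "\<forall>i<m. y i = x i" for y
      using W(2,3) m that by (force simp: PiE_UNIV_domain)
    then show "\<exists>m. \<forall>y. (\<forall>i<m. y i = x i) \<longrightarrow> y \<in> U" by blast
  qed
next
  assume R: "\<forall>x\<in>U. \<exists>m. \<forall>y. (\<forall>i<m. y i = x i) \<longrightarrow> y \<in> U"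
  have "\<exists>W. finite {i. W i \<noteq> UNIV} \<and> x \<in> PiE UNIV W \<and> PiE UNIV W \<subseteq> U" if "x \<in> U" for x
  proof -
    obtain m where m: "\<And>y. (\<forall>i<m. y i = x i) \<Longrightarrow> y \<in> U" using R \<open>x \<in> U\<close> by blast
    let ?W = "\<lambda>i. if i < m then {x i} else UNIV"
    have "finite {i. ?W i \<noteq> UNIV}"
      by (rule finite_subset[of _ "{..<m}"]) auto
    moreover have "x \<in> PiE UNIV ?W" by (simp add: PiE_UNIV_domain)
    moreover have "PiE UNIV ?W \<subseteq> U"
    proof
      fix y assume y: "y \<in> PiE UNIV ?W"
      have "y i = x i" if "i < m" for i
        using PiE_mem[OF y, of i] that by simp
      then show "y \<in> U" using m by blast
    qed
    ultimately show ?thesis by (intro exI[of _ ?W] conjI)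
  qed
  then show "openin cantor_space U"
    unfolding cantor_space_def openin_product_topology_alt by simp
qed

lemma continuous_read:
  assumes "\<And>p. enat (g p) < \<alpha>"
  shows "continuous_map cantor_space (L_space \<alpha>) (read g)"
  unfolding continuous_map topspace_cantor_space
proof (intro conjI allI impI)
  show "read g ` UNIV \<subseteq> topspace (L_space \<alpha>)"
    using read_in_all_seqs[of g] assms by (auto simp: topspace_L_space)
  fix U assume U: "openin (L_space \<alpha>) U"
  have "\<exists>m. \<forall>y. (\<forall>i<m. y i = x i) \<longrightarrow> read g y \<in> U" if "read g x \<in> U" for x
  proof -
    obtain a where a: "a \<in> fin_seqs \<alpha>" "a \<subseteq>\<^sub>m read g x" "{b \<in> all_seqs \<alpha>. a \<subseteq>\<^sub>m b} \<subseteq> U"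
      using U \<open>read g x \<in> U\<close> unfolding openin_L_space_iff by blast
    have "finite (dom a)" using a(1) by (auto simp: fin_seqs_def)
    then obtain m where m: "a \<subseteq>\<^sub>m read g (truncate m x)"
      using finite_part_read_from_truncation a(2) by blast
    have "read g y \<in> U" if "\<forall>i<m. y i = x i" for y
    proof -
      have "read g (truncate m x) \<subseteq>\<^sub>m read g y"
        by (rule read_truncate_le) (use that in blast)
      then have "a \<subseteq>\<^sub>m read g y"
        by (rule map_le_trans[OF m])
      moreover have "read g y \<in> all_seqs \<alpha>"
        by (rule read_in_all_seqs) (rule assms)
      ultimately show ?thesis using a(3) by blast
    qed
    then show ?thesis by blast
  qed
  then show "openin cantor_space {x \<in> UNIV. read g x \<in> U}"
    by (simp add: openin_cantor_space_iff)
qed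

lemma read_onto_upset_in_all_seqs:
  assumes "\<And>v l. enat v < \<alpha> \<Longrightarrow> \<exists>p\<ge>l. g p = v"
    and b: "b \<in> all_seqs \<alpha>" and "read g (truncate m x) \<subseteq>\<^sub>m b"
  shows "\<exists>y. (\<forall>i<m. y i = x i) \<and> read g y = b"
proof (rule read_onto_upset)
  have "ran b \<subseteq> {k. enat k < \<alpha>}"
    using b by (auto simp: all_seqs_def fin_seqs_def)
  then show "\<exists>p\<ge>l. g p = v" if "v \<in> ran b" for v l
    using assms(1) that by blast
qed (use assms all_seqs_dom_downward in blast)+

lemma open_read:
  assumes lt: "\<And>p. enat (g p) < \<alpha>"
    and recurrent: "\<And>v l. enat v < \<alpha> \<Longrightarrow> \<exists>p\<ge>l. g p = v"
  shows "open_map cantor_space (L_space \<alpha>) (read g)"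
  unfolding open_map_def
proof (intro allI impI)
  fix U assume U: "openin cantor_space U"
  have "\<exists>a\<in>fin_seqs \<alpha>. a \<subseteq>\<^sub>m read g x \<and> {b \<in> all_seqs \<alpha>. a \<subseteq>\<^sub>m b} \<subseteq> read g ` U" if "x \<in> U" for x
  proof -
    obtain m where m: "\<And>y. (\<forall>i<m. y i = x i) \<Longrightarrow> y \<in> U"
      using bspec[OF iffD1[OF openin_cantor_space_iff U] \<open>x \<in> U\<close>] by blast
    have "b \<in> read g ` U" if b: "b \<in> all_seqs \<alpha>" "read g (truncate m x) \<subseteq>\<^sub>m b" for b
    proof -
      obtain y where "\<forall>i<m. y i = x i" "read g y = b"
        using read_onto_upset_in_all_seqs[OF recurrent b] by metis
      then show ?thesis using m by blast
    qed
    moreover have "read g (truncate m x) \<in> fin_seqs \<alpha>"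
      by (rule read_truncate_in_fin_seqs) (rule lt)
    moreover have "read g (truncate m x) \<subseteq>\<^sub>m read g x"
      by (rule read_truncate_le) simp
    ultimately show ?thesis by blast
  qed
  moreover have "read g ` U \<subseteq> all_seqs \<alpha>"
    by (intro image_subsetI read_in_all_seqs lt)
  ultimately show "openin (L_space \<alpha>) (read g ` U)"
    unfolding openin_L_space_iff by blast
qed

lemma surj_read:
  assumes "\<And>p. enat (g p) < \<alpha>"
    and "\<And>v l. enat v < \<alpha> \<Longrightarrow> \<exists>p\<ge>l. g p = v"
  shows "range (read g) = all_seqs \<alpha>"
proof -
  have "b \<in> range (read g)" if "b \<in> all_seqs \<alpha>" for b
  proof -
    have "read g (truncate 0 x) \<subseteq>\<^sub>m b" for x
      by (simp add: read_map_le_iff truncate_def)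
    then show ?thesis
      using read_onto_upset_in_all_seqs[OF assms(2) that] by blast
  qed
  then show ?thesis
    using read_in_all_seqs[of g] assms(1) by blast
qed

text \<open>
  Labelling the code of a pair by its first component gives each value infinitely many codes;
  the values outside the alphabet are replaced by \<open>0\<close>, which a nonempty alphabet contains.
\<close>

lemma recurrent_labelling_exists:
  fixes \<alpha> :: enat
  assumes "\<alpha> \<noteq> 0"
  obtains g :: "nat \<Rightarrow> nat" where "\<And>p. enat (g p) < \<alpha>"
    and "\<And>v l. enat v < \<alpha> \<Longrightarrow> \<exists>p\<ge>l. g p = v"
proof
  let ?g = "\<lambda>p. let v = fst (prod_decode p) in if enat v < \<alpha> then v else 0"
  show "enat (?g p) < \<alpha>" for p
    using assms by (simp add: Let_def zero_enat_def[symmetric])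
  show "\<exists>p\<ge>l. ?g p = v" if "enat v < \<alpha>" for v l
    using that le_prod_encode_2[of l v] by (intro exI[of _ "prod_encode (v, l)"]) simp
qed

theorem theorem7p2:
  fixes \<alpha> :: enat
  assumes "\<alpha> \<noteq> 0"
  shows "\<exists>f :: (nat \<Rightarrow> bool) \<Rightarrow> (nat \<rightharpoonup> nat).
           interior_map cantor_space (L_space \<alpha>) f \<and>
           f ` topspace cantor_space = topspace (L_space \<alpha>)"
proof -
  obtain g :: "nat \<Rightarrow> nat" where "\<And>p. enat (g p) < \<alpha>"
    and "\<And>v l. enat v < \<alpha> \<Longrightarrow> \<exists>p\<ge>l. g p = v"
    using recurrent_labelling_exists[OF assms] by blast
  then have "interior_map cantor_space (L_space \<alpha>) (read g) \<and>
      read g ` topspace cantor_space = topspace (L_space \<alpha>)"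
    unfolding interior_map_def topspace_cantor_space topspace_L_space
    using continuous_read open_read surj_read by blast
  then show ?thesis by blast
qed

end
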